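(* For every $\epsilon>0$ there is a constant $C_\epsilon>0$ such that for every natural number $Q\ge 1$ the group $\Gamma_0(Q)$ is generated by the set $$\{\gamma\in\Gamma_0(Q)\ :\ \|\gamma\|_F\le C_\epsilon\, Q^{1+\epsilon}\}.$$
   Context: $\Gamma_0(Q)=\left\{\begin{pmatrix} a & b\\ c& d\end{pmatrix}\in \mathrm{SL}_2(\mathbb{Z}) : c\equiv 0 \bmod Q\right\}$, and $\|\cdot\|_F$ denotes the Frobenius norm, $\|\begin{pmatrix} a & b\\ c& d\end{pmatrix}\|_F=(a^2+b^2+c^2+d^2)^{1/2}$. *)

theory Defs
  imports "HOL-Analysis.Analysis" "HOL-Number_Theory.Cong" "HOL-Algebra.Generated_Groups"
begin

definition SL2Z :: "(int ^ 2 ^ 2) monoid" where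
  "SL2Z = \<lparr>carrier = {A. det A = 1}, mult = (**), one = mat 1\<rparr>"

text \<open>The entry \<open>\<gamma> $ i $ j\<close> is in row \<open>i\<close> and column \<open>j\<close>, so \<open>\<gamma> $ 2 $ 1\<close> is the lower left entry.\<close>

definition Gamma0 :: "nat \<Rightarrow> (int ^ 2 ^ 2) set" where
  "Gamma0 Q = {\<gamma> \<in> carrier SL2Z. [\<gamma> $ 2 $ 1 = 0] (mod int Q)}"

definition frobenius_norm :: "int ^ 'n ^ 'm \<Rightarrow> real" where
  "frobenius_norm A = sqrt (\<Sum>i\<in>UNIV. \<Sum>j\<in>UNIV. (real_of_int (A $ i $ j))\<^sup>2)"

lemma SL2Z_inverse:
  fixes A :: "int ^ 2 ^ 2"
  assumes "det A = 1"
  defines "B \<equiv> (\<chi> i j. if i = j then (if i = 1 then A $ 2 $ 2 else A $ 1 $ 1) else - A $ i $ j)"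
  shows "det B = 1" "B ** A = mat 1"
proof -
  have n: "(1::2) \<noteq> 2" "(2::2) \<noteq> 1" by simp_all
  show "det B = 1" using assms(1) n by (simp add: B_def det_2 mult.commute)
  show "B ** A = mat 1" using assms(1) n
    by (simp add: B_def det_2 matrix_matrix_mult_def mat_def vec_eq_iff forall_2 sum_2 algebra_simps)
qed

lemma group_SL2Z: "group SL2Z"
proof (rule groupI)
  fix x assume "x \<in> carrier SL2Z"
  then show "\<exists>y\<in>carrier SL2Z. y \<otimes>\<^bsub>SL2Z\<^esub> x = \<one>\<^bsub>SL2Z\<^esub>"
    using SL2Z_inverse[of x] by (auto simp: SL2Z_def)
qed (auto simp: SL2Z_def det_mul matrix_mul_assoc)

lemma subgroup_Gamma0: "subgroup (Gamma0 Q) SL2Z"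
proof -
  interpret group SL2Z by (rule group_SL2Z)
  show ?thesis
  proof (rule subgroupI)
    show "Gamma0 Q \<subseteq> carrier SL2Z" by (auto simp: Gamma0_def)
    have "mat 1 \<in> Gamma0 Q" by (simp add: Gamma0_def SL2Z_def mat_def det_2)
    then show "Gamma0 Q \<noteq> {}" by blast
  next
    fix A assume A: "A \<in> Gamma0 Q"
    then have d: "det A = 1" by (simp add: Gamma0_def SL2Z_def)
    let ?B = "\<chi> i j. if i = j then (if i = 1 then A $ 2 $ 2 else A $ 1 $ 1) else - A $ i $ j"
    have "inv\<^bsub>SL2Z\<^esub> A = ?B"
      by (rule inv_equality) (use SL2Z_inverse[OF d] d in \<open>auto simp: SL2Z_def\<close>)
    then show "inv\<^bsub>SL2Z\<^esub> A \<in> Gamma0 Q"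
      using A SL2Z_inverse(1)[OF d] by (simp add: Gamma0_def SL2Z_def cong_0_iff)
  next
    fix A B assume "A \<in> Gamma0 Q" "B \<in> Gamma0 Q"
    moreover have "(A ** B) $ 2 $ 1 = A $ 2 $ 1 * B $ 1 $ 1 + A $ 2 $ 2 * B $ 2 $ 1"
      by (simp add: matrix_matrix_mult_def sum_2)
    ultimately show "A \<otimes>\<^bsub>SL2Z\<^esub> B \<in> Gamma0 Q"
      by (simp add: Gamma0_def SL2Z_def det_mul cong_0_iff)
  qed
qed

end

theory Submission
  imports Defs "HOL-Library.Real_Mod"
begin

text \<open>
  Multiplying on both sides by powers of the translation \<open>(1 1; 0 1)\<close> reduces the diagonal entries
  modulo the lower left entry \<open>c\<close>, so elements with \<open>\<bar>c\<bar> \<le> M\<close> are products of elements of norm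
  \<open>\<le> 4 M\<close>. It remains to generate \<open>\<Gamma>\<^sub>0(Q)\<close> by elements with \<open>\<bar>c\<bar> \<le> Q J\<^sup>2\<close>, where \<open>J\<close> is a
  small power of \<open>Q\<close>.
  Let \<open>\<gamma>\<close> have bottom row \<open>(Q k, d)\<close> with \<open>\<bar>k\<bar> > J\<^sup>2\<close>. If \<open>\<delta>\<close> has first column \<open>(x, Q m)\<close>, then
  \<open>\<gamma> \<delta>\<close> has lower left entry \<open>Q (k x + d m)\<close>, so we need \<open>1 \<le> m \<le> J\<^sup>2\<close> and \<open>x\<close> prime to \<open>Q m\<close>
  with \<open>\<bar>x + m d / k\<bar> < 1\<close>. By Dirichlet, \<open>q d / k = A + \<eta>\<close> with \<open>1 \<le> q \<le> J\<close> and \<open>0 < \<bar>\<eta>\<bar> < 1 / J\<close>.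
  For every \<open>1 \<le> j \<le> J\<close> both conditions on size hold for \<open>m = q j\<close> and \<open>- x = j A + sgn \<eta>\<close>, and
  \<open>x\<close> is prime to \<open>j\<close>. A Jacobsthal-type bound, with \<open>2\<^bsup>\<omega>(n)\<^esup>\<close> consecutive \<open>j\<close> for the modulus
  \<open>n = Q q\<close>, makes \<open>x\<close> prime to \<open>Q q\<close> for one of them.
\<close>

section \<open>Coprime values in short arithmetic progressions\<close>

text \<open>The combination \<open>f (Suc x) - z k * f x\<close> removes the term of
  \<open>k\<close> and multiplies the other coefficients by \<open>z i - z k\<close>, which is why
  \<open>c\<close> varies in the induction. It has one initial zero fewer than \<open>f\<close>,
  just enough for the smaller index set; \<open>f\<close> then obeys a first-order recurrence
  starting from 0.\<close>

lemma exponential_sum_eq_0: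
  fixes c z :: "'i \<Rightarrow> 'a::comm_ring_1"
  assumes "finite I" and "\<And>x. x < card I \<Longrightarrow> (\<Sum>i\<in>I. c i * z i ^ x) = 0"
  shows "(\<Sum>i\<in>I. c i * z i ^ x) = 0"
  using assms
proof (induction I arbitrary: c x rule: finite_induct)
  case (insert k I)
  define f where "f x = (\<Sum>i\<in>insert k I. c i * z i ^ x)" for x
  have step: "f (Suc x) - z k * f x = (\<Sum>i\<in>I. (c i * (z i - z k)) * z i ^ x)" for x
    using insert.hyps
    by (simp add: f_def sum_distrib_left algebra_simps sum_subtractf)
  have vanish: "f x = 0" if "x < Suc (card I)" for x
    using insert.prems[of x] insert.hyps that by (simp add: f_def)
  have "(\<Sum>i\<in>I. (c i * (z i - z k)) * z i ^ x) = 0" for x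
    by (rule insert.IH) (simp add: step[symmetric] vanish)
  then have "f (Suc x) = z k * f x" for x
    using step[of x] by simp
  then have "f x = 0" for x
    by (induction x) (simp_all add: vanish)
  then show ?case by (simp add: f_def)
qed simp

lemma exists_in_progression_not_dvd:
  fixes A s :: int and P :: "nat set"
  assumes P: "finite P" "\<And>p. p \<in> P \<Longrightarrow> p > 0" and s: "\<And>p. p \<in> P \<Longrightarrow> \<not> int p dvd s"
  shows "\<exists>j\<in>{1..2 ^ card P}. \<forall>p\<in>P. \<not> int p dvd int j * A + s"
proof (rule ccontr)
  \<comment> \<open>\<open>f x\<close> vanishes iff some \<open>p\<close> divides \<open>x A + s\<close>. It is a sum of \<open>2\<^bsup>card P\<^esup>\<close> exponentials in \<open>x\<close>,
    so vanishing on that many consecutive \<open>x\<close> would make it vanish everywhere, also at a common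
    multiple of \<open>P\<close>, where \<open>x A + s\<close> is congruent to \<open>s\<close>.\<close>
  define e where "e y p = cis (2 * pi * real_of_int y / real p)" for y p
  define f where "f x = (\<Prod>p\<in>P. 1 - e (int x * A + s) p)" for x
  have e_eq_1: "e y p = 1 \<longleftrightarrow> int p dvd y" if "p \<in> P" for y p
  proof -
    have p: "p > 0" using P(2) that .
    have "e y p = 1 \<longleftrightarrow> (\<exists>n. 2 * pi * real_of_int y / real p = of_int n * (2 * pi))"
      by (simp add: e_def cis_eq_1_iff)
    also have "\<dots> \<longleftrightarrow> (\<exists>n. real_of_int y = real_of_int (int p * n))"
      using p by (intro arg_cong[of _ _ Ex] ext) (auto simp: field_simps)
    also have "\<dots> \<longleftrightarrow> int p dvd y"
      by (auto simp only: of_int_eq_iff dvd_def)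
    finally show ?thesis .
  qed
  have f_eq_0: "f x = 0 \<longleftrightarrow> (\<exists>p\<in>P. int p dvd int x * A + s)" for x
    using P(1) e_eq_1 by (force simp: f_def)
  have e_linear: "e (int x * A + t) p = e t p * e A p ^ x" for x t p
    by (simp add: e_def Complex.DeMoivre cis_mult algebra_simps add_divide_distrib)
  \<comment> \<open>Each subset \<open>X\<close> contributes one geometric term. The shift to
    \<open>Suc x\<close> makes the progression start at \<open>j = 1\<close> and turns
    \<open>s\<close> into \<open>A + s\<close> in the coefficients.\<close>
  have f_expand: "f (Suc x) =
      (\<Sum>X\<in>Pow P. ((-1) ^ card X * (\<Prod>p\<in>X. e (A + s) p)) * (\<Prod>p\<in>X. e A p) ^ x)" for x
    using P(1) e_linear[of x "A + s"]
    by (simp add: f_def prod_diff_conv_sum prod.distrib prod_power_distrib algebra_simps)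
  assume covered: "\<not> ?thesis"
  have zero: "f (Suc x) = 0" if "x < 2 ^ card P" for x
  proof -
    have "Suc x \<in> {1..2 ^ card P}" using that by simp
    then show ?thesis using covered unfolding f_eq_0 by blast
  qed
  have vanish: "f (Suc x) = 0" for x
    unfolding f_expand
  proof (rule exponential_sum_eq_0)
    fix y assume "y < card (Pow P)"
    then have "f (Suc y) = 0" using P(1) by (intro zero) (simp add: card_Pow)
    then show "(\<Sum>X\<in>Pow P. ((-1) ^ card X * (\<Prod>p\<in>X. e (A + s) p)) * (\<Prod>p\<in>X. e A p) ^ y) = 0"
      by (simp only: f_expand)
  qed (use P(1) in simp)
  define N where "N = (\<Prod>p\<in>P. p)"
  have "N > 0" using P by (auto simp: N_def intro!: prod_pos)
  then have "f N = 0" using vanish[of "N - 1"] by simp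
  then obtain p where p: "p \<in> P" "int p dvd int N * A + s" unfolding f_eq_0 by blast
  have "p dvd N" unfolding N_def using P(1) p(1) by (rule dvd_prodI)
  then have "int p dvd int N * A" by simp
  then show False using p s by (simp add: dvd_add_right_iff)
qed

lemma exists_in_progression_coprime:
  fixes A s :: int and n :: nat
  assumes "n > 0" and "coprime s (int n)"
  shows "\<exists>j\<in>{1..2 ^ card (prime_factors n)}. coprime (int j * A + s) (int n)"
proof -
  have "\<not> int p dvd s" if "p \<in> prime_factors n" for p
    using that assms(2) by (auto simp: in_prime_factors_iff dest: coprime_common_divisor)
  then obtain j where j: "j \<in> {1..2 ^ card (prime_factors n)}"
    "\<forall>p\<in>prime_factors n. \<not> int p dvd int j * A + s"
    using exists_in_progression_not_dvd[of "prime_factors n" s A]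
    by (auto simp: in_prime_factors_iff prime_gt_0_nat)
  have "coprime (int j * A + s) (int n)"
  proof (rule ccontr)
    define g where "g = nat (gcd (int j * A + s) (int n))"
    have g: "int g = gcd (int j * A + s) (int n)" by (simp add: g_def)
    assume "\<not> ?thesis"
    then have "g \<noteq> 1" using g by (auto simp: coprime_iff_gcd_eq_1)
    then obtain p where p: "prime p" "p dvd g" using prime_factor_nat by blast
    then have "int p dvd int g" by simp
    then have "int p dvd int j * A + s" "int p dvd int n"
      unfolding g by (auto dest: dvd_trans)
    with p(1) show False using j(2) assms(1) by (auto simp: in_prime_factors_iff)
  qed
  with j show ?thesis by blast
qed

section \<open>Growth of the sieve length\<close>

text \<open>A prime \<open>p > M\<close> pays for its factor 2 with \<open>p powr \<delta>\<close>;
  the at most \<open>M\<close> smaller primes cost the constant \<open>2 ^ M\<close>. The product of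
  the distinct prime factors divides \<open>n\<close>.\<close>

lemma two_power_omega_le:
  fixes \<delta> :: real
  assumes "\<delta> > 0"
  shows "\<exists>C\<ge>1. \<forall>n>0. 2 ^ card (prime_factors n) \<le> C * real n powr \<delta>"
proof -
  define M :: nat where "M = nat \<lceil>2 powr (1 / \<delta>)\<rceil>"
  have large: "2 \<le> real p powr \<delta>" if "p > M" for p
  proof -
    have "2 powr (1 / \<delta>) \<le> real p" using that by (simp add: M_def) linarith
    then have "(2 powr (1 / \<delta>)) powr \<delta> \<le> real p powr \<delta>"
      using assms by (intro powr_mono2) auto
    then show ?thesis using assms by (simp add: powr_powr)
  qed
  have "2 ^ card (prime_factors n) \<le> 2 ^ M * real n powr \<delta>" if n: "n > 0" for n :: nat
  proof -
    let ?P = "prime_factors n"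
    have dvd: "(\<Prod>p\<in>?P. p) dvd n"
    proof -
      have "(\<Prod>p\<in>?P. p) dvd (\<Prod>p\<in>?P. p ^ multiplicity p n)"
        by (intro prod_dvd_prod dvd_power) (auto simp: prime_factors_multiplicity)
      then show ?thesis using n by (simp add: prod_prime_factors)
    qed
    have "(2::real) ^ card ?P = (\<Prod>p\<in>?P. 2)" by simp
    also have "\<dots> \<le> (\<Prod>p\<in>?P. (if p \<in> {1..M} then 2 else 1) * real p powr \<delta>)"
    proof (intro prod_mono conjI)
      fix p assume p: "p \<in> ?P"
      then have "p \<ge> 1" by (auto simp: in_prime_factors_iff dest: prime_gt_0_nat)
      moreover have "1 \<le> real p powr \<delta>" using \<open>p \<ge> 1\<close> assms by (simp add: ge_one_powr_ge_zero)
      ultimately show "2 \<le> (if p \<in> {1..M} then 2 else 1) * real p powr \<delta>"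
        using large[of p] by auto
    qed simp
    also have "\<dots> = 2 ^ card (?P \<inter> {1..M}) * (\<Prod>p\<in>?P. real p powr \<delta>)"
      by (simp add: prod.distrib prod.If_cases del: atLeastAtMost_iff)
    also have "(\<Prod>p\<in>?P. real p powr \<delta>) = real (\<Prod>p\<in>?P. p) powr \<delta>"
      by (simp add: prod_powr_distrib)
    also have "2 ^ card (?P \<inter> {1..M}) * real (\<Prod>p\<in>?P. p) powr \<delta> \<le> 2 ^ M * real n powr \<delta>"
    proof (intro mult_mono powr_mono2 power_increasing)
      show "card (?P \<inter> {1..M}) \<le> M" using card_mono[of "{1..M}" "?P \<inter> {1..M}"] by simp
      show "real (\<Prod>p\<in>?P. p) \<le> real n" using dvd_imp_le[OF dvd n] by linarith
    qed (use assms in \<open>auto simp: prod_nonneg\<close>)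
    finally show ?thesis .
  qed
  then show ?thesis by (intro exI[of _ "2 ^ M"]) auto
qed

section \<open>The shortening fraction from Dirichlet approximation\<close>

lemma exists_shortening_fraction:
  fixes Q J :: nat and d k :: int
  assumes Q: "Q > 0"
    and J: "J > 0" "\<And>q. q \<in> {1..J} \<Longrightarrow> 2 ^ card (prime_factors (Q * q)) \<le> J"
    and dk: "coprime d k" and k: "\<bar>k\<bar> > int J"
  shows "\<exists>x m. m \<in> {1..J ^ 2} \<and> coprime x (int (Q * m)) \<and> \<bar>k * x + d * int m\<bar> < \<bar>k\<bar>"
proof -
  have k0: "k \<noteq> 0" using k by auto
  define \<theta> where "\<theta> = real_of_int d / real_of_int k"
  obtain A q' where q': "0 < q'" "q' \<le> int J" "\<bar>of_int q' * \<theta> - of_int A\<bar> < 1 / real J"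
    using Dirichlet_approx[OF J(1)] by metis
  define q where "q = nat q'"
  define \<eta> where "\<eta> = real q * \<theta> - of_int A"
  have q: "q \<in> {1..J}" and \<eta>: "\<bar>\<eta>\<bar> < 1 / real J"
    using q' by (auto simp: q_def \<eta>_def)
  \<comment> \<open>For \<open>\<eta> = 0\<close> the bound \<open>small\<close> below would fail,
    the distance to \<open>s\<close> being exactly 1. This case would force \<open>k\<close> to
    divide \<open>q\<close>, although \<open>0 < q \<le> J < \<bar>k\<bar>\<close>.\<close>
  have "\<eta> \<noteq> 0"
  proof
    assume "\<eta> = 0"
    then have "real_of_int (int q * d) = real_of_int (A * k)"
      using k0 by (simp add: \<eta>_def \<theta>_def field_simps)
    then have "int q * d = A * k" by linarith
    then have "k dvd int q * d" by simp
    then have "k dvd int q" using dk by (simp add: coprime_dvd_mult_left_iff coprime_commute)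
    then have "\<bar>k\<bar> \<le> int q" using q by (intro zdvd_imp_le) auto
    then show False using q k by auto
  qed
  \<comment> \<open>Since \<open>j * \<eta>\<close> is nonzero, of absolute value below 1 and of the
    sign of \<open>s\<close>, subtracting \<open>s\<close> keeps it strictly between -1 and 1. As a
    unit, \<open>s\<close> is also a valid start for the sieve.\<close>
  define s :: int where "s = (if \<eta> > 0 then 1 else -1)"
  have "coprime s (int (Q * q))" by (simp add: s_def)
  then obtain j where j: "j \<in> {1..2 ^ card (prime_factors (Q * q))}"
    and cop: "coprime (int j * A + s) (int (Q * q))"
    using exists_in_progression_coprime[of "Q * q" s A] Q q by auto
  have jJ: "j \<in> {1..J}" using j J(2)[OF q] by auto
  define x where "x = - (int j * A + s)"
  have "\<bar>real j * \<eta>\<bar> < 1"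
  proof -
    have "\<bar>real j * \<eta>\<bar> \<le> real J * \<bar>\<eta>\<bar>" using jJ by (simp add: abs_mult mult_right_mono)
    also have "\<dots> < 1" using \<eta> J(1) by (simp add: field_simps)
    finally show ?thesis .
  qed
  moreover have "real j * \<eta> > 0" if "\<eta> > 0" using jJ that by simp
  moreover have "real j * \<eta> < 0" if "\<eta> < 0" using jJ that by (simp add: mult_less_0_iff)
  ultimately have small: "\<bar>real j * \<eta> - of_int s\<bar> < 1" 
    using \<open>\<eta> \<noteq> 0\<close> unfolding s_def by (cases "\<eta> > 0") (simp_all add: abs_less_iff)
  have "real_of_int (k * x + d * int (q * j)) = of_int k * (real j * \<eta> - of_int s)"
    using k0 by (simp add: \<eta>_def \<theta>_def x_def field_simps)
  then have "\<bar>real_of_int (k * x + d * int (q * j))\<bar> < \<bar>of_int k\<bar>"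
    using small k0 by (simp only: abs_mult) simp
  then have "\<bar>k * x + d * int (q * j)\<bar> < \<bar>k\<bar>" by linarith
  moreover have "coprime x (int (Q * (q * j)))"
  proof -
    \<comment> \<open>Modulo \<open>j\<close> only the unit \<open>s\<close> remains, so the sieve
      modulus \<open>Q * q\<close> does not have to involve the unknown \<open>j\<close>.\<close>
    have "coprime (int j * A + s) (int j)"
      by (simp add: s_def coprime_iff_gcd_eq_1 gcd.commute gcd_add_mult mult.commute)
    with cop have "coprime (int j * A + s) (int (Q * q) * int j)" by simp
    then show ?thesis
      unfolding x_def coprime_minus_left_iff of_nat_mult mult.assoc .
  qed
  moreover have "q * j \<in> {1..J ^ 2}"
    using q jJ by (auto simp: power2_eq_square intro: mult_le_mono)
  ultimately show ?thesis by blast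
qed

section \<open>Explicit 2 by 2 matrices, norms and translations\<close>

definition mat2 :: "'a \<Rightarrow> 'a \<Rightarrow> 'a \<Rightarrow> 'a::zero \<Rightarrow> 'a ^ 2 ^ 2" where
  "mat2 a b c d = vector [vector [a, b], vector [c, d]]"

lemma mat2_nth [simp]:
  "mat2 a b c d $ 1 $ 1 = a" "mat2 a b c d $ 1 $ 2 = b"
  "mat2 a b c d $ 2 $ 1 = c" "mat2 a b c d $ 2 $ 2 = d"
  by (simp_all add: mat2_def)

lemma matrix2_cases:
  obtains a b c d where "A = mat2 a b c d"
proof
  show "A = mat2 (A $ 1 $ 1) (A $ 1 $ 2) (A $ 2 $ 1) (A $ 2 $ 2)"
    by (simp add: vec_eq_iff forall_2)
qed

lemma matrix2_eq_iff:
  fixes A B :: "'a ^ 2 ^ 2"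
  shows "A = B \<longleftrightarrow> A $ 1 $ 1 = B $ 1 $ 1 \<and> A $ 1 $ 2 = B $ 1 $ 2 \<and>
    A $ 2 $ 1 = B $ 2 $ 1 \<and> A $ 2 $ 2 = B $ 2 $ 2"
  by (auto simp: vec_eq_iff forall_2)

lemma mat2_mult:
  fixes a :: "'a::semiring_1"
  shows "mat2 a b c d ** mat2 a' b' c' d' =
    mat2 (a * a' + b * c') (a * b' + b * d') (c * a' + d * c') (c * b' + d * d')"
  by (simp add: matrix2_eq_iff matrix_matrix_mult_def sum_2)

lemma mat_1_eq_mat2: "mat 1 = mat2 1 0 0 1"
  by (simp add: matrix2_eq_iff mat_def)

lemma det_mat2 [simp]: "det (mat2 a b c d) = a * d - b * c"
  by (simp add: det_2)

lemma mult_SL2Z: "A \<otimes>\<^bsub>SL2Z\<^esub> B = A ** B"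
  by (simp add: SL2Z_def)

lemma mat2_in_Gamma0_iff: "mat2 a b c d \<in> Gamma0 Q \<longleftrightarrow> a * d - b * c = 1 \<and> int Q dvd c"
  by (simp add: Gamma0_def SL2Z_def cong_0_iff)

lemma inv_SL2Z_mat2:
  assumes "a * d - b * c = 1"
  shows "inv\<^bsub>SL2Z\<^esub> (mat2 a b c d) = mat2 d (- b) (- c) a"
proof -
  interpret group SL2Z by (rule group_SL2Z)
  show ?thesis
    by (rule inv_equality)
      (use assms in \<open>simp_all add: SL2Z_def mat2_mult mat_1_eq_mat2 matrix2_eq_iff algebra_simps\<close>)
qed

lemma frobenius_norm_le:
  fixes A :: "int ^ 2 ^ 2"
  assumes "\<And>i j. \<bar>real_of_int (A $ i $ j)\<bar> \<le> M"
  shows "frobenius_norm A \<le> 2 * M"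
proof -
  have M: "M \<ge> 0" using assms[of 1 1] by linarith
  have "(real_of_int (A $ i $ j))\<^sup>2 \<le> M\<^sup>2" for i j
    using assms[of i j] M by (simp add: abs_le_square_iff[symmetric])
  then have "(\<Sum>i\<in>UNIV. \<Sum>j\<in>UNIV. (real_of_int (A $ i $ j))\<^sup>2) \<le> (\<Sum>i\<in>(UNIV::2 set). \<Sum>j\<in>(UNIV::2 set). M\<^sup>2)"
    by (intro sum_mono)
  also have "\<dots> = (2 * M)\<^sup>2" by (simp add: sum_2 power2_eq_square)
  finally show ?thesis
    unfolding frobenius_norm_def using M by (intro real_le_lsqrt) auto
qed

lemma translation_in_subgroup:
  assumes H: "subgroup H SL2Z" and T: "mat2 1 1 0 1 \<in> H"
  shows "mat2 1 n 0 1 \<in> H"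
proof -
  have pos: "mat2 1 (int n) 0 1 \<in> H" for n
  proof (induction n)
    case 0
    then show ?case
      using subgroup.one_closed[OF H] by (simp add: SL2Z_def mat_1_eq_mat2)
  next
    case (Suc n)
    show ?case
      using subgroup.m_closed[OF H Suc T] by (simp add: mult_SL2Z mat2_mult algebra_simps)
  qed
  show ?thesis
  proof (cases "n \<ge> 0")
    case True
    then show ?thesis using pos[of "nat n"] by simp
  next
    case False
    then show ?thesis
      using subgroup.m_inv_closed[OF H pos[of "nat (- n)"]] by (simp add: inv_SL2Z_mat2)
  qed
qed

section \<open>Reduction to small lower left entries\<close>

text \<open>Translations on the left and right change \<open>a\<close> and \<open>d\<close> by
  multiples of \<open>c\<close>. Once both are reduced modulo \<open>c\<close>, the determinant also
  bounds the upper right entry by \<open>\<bar>c\<bar>\<close>.\<close>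

lemma small_lower_left_in_subgroup:
  assumes H: "subgroup H SL2Z" and M: "M \<ge> 1"
    and gens: "\<And>\<gamma>. \<gamma> \<in> Gamma0 Q \<Longrightarrow> frobenius_norm \<gamma> \<le> 4 * M \<Longrightarrow> \<gamma> \<in> H"
    and \<gamma>: "mat2 a b c d \<in> Gamma0 Q" and c: "\<bar>real_of_int c\<bar> \<le> M"
  shows "mat2 a b c d \<in> H"
proof -
  have det: "a * d - b * c = 1" and Qc: "int Q dvd c"
    using \<gamma> by (auto simp: mat2_in_Gamma0_iff)
  have small: "mat2 a b c d \<in> H" if "mat2 a b c d \<in> Gamma0 Q"
      "\<bar>real_of_int a\<bar> \<le> 2 * M" "\<bar>real_of_int b\<bar> \<le> 2 * M"
      "\<bar>real_of_int c\<bar> \<le> 2 * M" "\<bar>real_of_int d\<bar> \<le> 2 * M" for a b c d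
  proof (rule gens)
    have "\<forall>i j. \<bar>real_of_int (mat2 a b c d $ i $ j)\<bar> \<le> 2 * M"
      using that by (simp add: forall_2)
    then show "frobenius_norm (mat2 a b c d) \<le> 4 * M"
      using frobenius_norm_le[of "mat2 a b c d" "2 * M"] by simp
  qed fact
  have "mat2 1 1 0 1 \<in> H" using M by (intro small) (auto simp: mat2_in_Gamma0_iff)
  then have T: "mat2 1 n 0 1 \<in> H" for n by (rule translation_in_subgroup[OF H])
  show ?thesis
  proof (cases "c = 0")
    case True
    then have "a * d = 1" using det by simp
    then have ad: "a = d" "\<bar>a\<bar> = 1" by (auto simp: zmult_eq_1_iff)
    \<comment> \<open>Here \<open>a = d\<close> is a sign, so the matrix is plus or minus the
      identity times the translation by \<open>a * b\<close>.\<close>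
    have "mat2 a 0 0 a \<in> H"
      using M ad \<open>a * d = 1\<close> by (intro small) (auto simp: mat2_in_Gamma0_iff)
    from subgroup.m_closed[OF H this T[of "a * b"]] show ?thesis
      using \<open>a * d = 1\<close> ad True by (simp add: mult_SL2Z mat2_mult flip: mult.assoc)
  next
    case False
    define i where "i = a div c"
    define j where "j = d div c"
    \<comment> \<open>The upper right entry after multiplying by the translation by
      \<open>- i\<close> on the left and by \<open>- j\<close> on the right.\<close>
    define b' where "b' = b - i * d - j * (a mod c)"
    have a: "a = a mod c + i * c" and d: "d = d mod c + j * c" by (simp_all add: i_def j_def)
    have det': "(a mod c) * (d mod c) - b' * c = 1"
    proof -
      have "a mod c = a - i * c" "d mod c = d - j * c" using a d by linarith+
      then have "(a mod c) * (d mod c) - b' * c = (a - i * c) * (d - j * c) - (b - i * d - j * (a - i * c)) * c"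
        by (simp only: b'_def)
      also have "\<dots> = a * d - b * c" by (simp add: algebra_simps)
      finally show ?thesis using det by simp
    qed
    have mods: "\<bar>a mod c\<bar> < \<bar>c\<bar>" "\<bar>d mod c\<bar> < \<bar>c\<bar>"
      using False by (auto intro: abs_mod_less)
    have "\<bar>b'\<bar> * \<bar>c\<bar> = \<bar>(a mod c) * (d mod c) - 1\<bar>" using det' by (simp add: abs_mult[symmetric])
    also have "\<dots> \<le> \<bar>a mod c\<bar> * \<bar>d mod c\<bar> + 1" by (simp add: abs_mult[symmetric])
    also have "\<dots> \<le> (\<bar>c\<bar> - 1) * \<bar>c\<bar> + \<bar>c\<bar>"
      using mods False by (intro add_mono mult_mono) auto
    also have "\<dots> = \<bar>c\<bar> * \<bar>c\<bar>" by (simp add: algebra_simps)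
    finally have "\<bar>b'\<bar> \<le> \<bar>c\<bar>" using False by (meson mult_right_le_imp_le zero_less_abs_iff)
    then have "mat2 (a mod c) b' c (d mod c) \<in> H"
      using mods c M det' Qc by (intro small) (auto simp: mat2_in_Gamma0_iff)
    from subgroup.m_closed[OF H subgroup.m_closed[OF H T[of i] this] T[of j]]
    have "mat2 (a mod c + i * c) ((a mod c + i * c) * j + (b' + i * (d mod c))) c (c * j + d mod c) \<in> H"
      by (simp add: mult_SL2Z mat2_mult)
    moreover have "(a mod c + i * c) * j + (b' + i * (d mod c)) = b"
    proof -
      have mods: "a mod c = a - i * c" "d mod c = d - j * c" using a d by linarith+
      show ?thesis unfolding b'_def mods by (simp add: algebra_simps)
    qed
    ultimately show ?thesis using a d by (simp add: mult.commute add.commute)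
  qed
qed

text \<open>Descent on \<open>\<bar>c\<bar>\<close>: above the threshold, a right factor from
  \<open>H\<close> makes it strictly smaller, and the factor is cancelled afterwards inside
  \<open>H\<close>.\<close>

lemma Gamma0_subset_if_small_lower_left:
  fixes Q J :: nat
  assumes H: "subgroup H SL2Z" and Q: "Q > 0"
    and J: "J > 0" "\<And>q. q \<in> {1..J} \<Longrightarrow> 2 ^ card (prime_factors (Q * q)) \<le> J"
    and small: "\<And>a b c d. mat2 a b c d \<in> Gamma0 Q \<Longrightarrow> \<bar>c\<bar> \<le> int (Q * J\<^sup>2) \<Longrightarrow> mat2 a b c d \<in> H"
  shows "Gamma0 Q \<subseteq> H"
proof -
  interpret group SL2Z by (rule group_SL2Z)
  have "mat2 a b c d \<in> H" if "mat2 a b c d \<in> Gamma0 Q" for a b c d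
    using that
  proof (induction "nat \<bar>c\<bar>" arbitrary: a b c d rule: less_induct)
    case less
    have det: "a * d - b * c = 1" and "int Q dvd c"
      using less.prems by (auto simp: mat2_in_Gamma0_iff)
    then obtain k where c: "c = int Q * k" by blast
    show ?case
    proof (cases "\<bar>c\<bar> \<le> int (Q * J\<^sup>2)")
      case True
      then show ?thesis using small less.prems by blast
    next
      case False
      then have k: "int (J\<^sup>2) < \<bar>k\<bar>"
        using Q by (simp add: c abs_mult)
      moreover have "J \<le> J\<^sup>2" using J(1) by (simp add: power2_eq_square)
      ultimately have "int J < \<bar>k\<bar>" by linarith
      moreover have "coprime d k"
      proof (rule coprimeI)
        fix e assume "e dvd d" "e dvd k"
        then have "e dvd a * d - b * c" by (simp add: c)
        then show "is_unit e" using det by simp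
      qed
      ultimately obtain x m where m: "m \<in> {1..J\<^sup>2}" and cop: "coprime x (int (Q * m))"
        and less_k: "\<bar>k * x + d * int m\<bar> < \<bar>k\<bar>"
        using exists_shortening_fraction[OF Q J] by blast
      obtain u v where uv: "x * u - v * int (Q * m) = 1"
      proof -
        obtain u v where "u * x + v * int (Q * m) = 1"
          using bezout_int[of x "int (Q * m)"] cop by auto
        then show ?thesis using that[of u "- v"] by (simp add: mult.commute)
      qed
      let ?\<delta> = "mat2 x v (int (Q * m)) u"
      have \<delta>: "?\<delta> \<in> Gamma0 Q" using uv by (simp add: mat2_in_Gamma0_iff)
      \<comment> \<open>The bound \<open>m \<le> J\<^sup>2\<close> puts the lower left entry
        \<open>Q * m\<close> within the reach of \<open>small\<close>.\<close>
      have "?\<delta> \<in> H"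
        using \<delta> m by (intro small) (auto simp flip: of_nat_mult)
      let ?c = "c * x + d * int (Q * m)"
      have prod: "mat2 a b c d ** ?\<delta> = mat2 (a * x + b * int (Q * m)) (a * v + b * u) ?c (c * v + d * u)"
        by (rule mat2_mult)
      have "?c = int Q * (k * x + d * int m)" by (simp add: c algebra_simps)
      then have "nat \<bar>?c\<bar> < nat \<bar>c\<bar>"
        using less_k Q by (simp add: c abs_mult nat_less_eq_zless)
      moreover have "mat2 a b c d ** ?\<delta> \<in> Gamma0 Q"
        using subgroup.m_closed[OF subgroup_Gamma0 less.prems \<delta>] by (simp only: mult_SL2Z)
      ultimately have "mat2 a b c d ** ?\<delta> \<in> H"
        unfolding prod by (rule less.hyps)
      from subgroup.m_closed[OF H this subgroup.m_inv_closed[OF H \<open>?\<delta> \<in> H\<close>]]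
      have "(mat2 a b c d \<otimes>\<^bsub>SL2Z\<^esub> ?\<delta>) \<otimes>\<^bsub>SL2Z\<^esub> inv\<^bsub>SL2Z\<^esub> ?\<delta> \<in> H"
        by (simp only: mult_SL2Z)
      moreover have "mat2 a b c d \<in> carrier SL2Z" "?\<delta> \<in> carrier SL2Z"
        using less.prems \<delta> by (auto simp: Gamma0_def)
      ultimately show ?thesis by (simp add: m_assoc)
    qed
  qed
  then show ?thesis by (metis matrix2_cases subsetI)
qed

section \<open>Choice of parameters and conclusion\<close>

text \<open>The condition is circular, as \<open>J\<close> bounds both \<open>q\<close> and the
  sieve length. It is solvable because the sieve length is at most \<open>Y * sqrt J\<close>, which
  is at most \<open>J\<close> once \<open>J \<ge> Y\<^sup>2\<close>. Rounding
  \<open>Y\<^sup>2\<close> up at most doubles it, whence \<open>D = 2 * C ^ 4\<close>.\<close>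

lemma exists_sieve_bound:
  fixes \<epsilon> :: real
  assumes "\<epsilon> > 0"
  shows "\<exists>D\<ge>1. \<forall>Q>0. \<exists>J>0. real J \<le> D * real Q powr \<epsilon> \<and>
    (\<forall>q\<in>{1..J}. 2 ^ card (prime_factors (Q * q)) \<le> J)"
proof -
  define \<delta> where "\<delta> = min (\<epsilon> / 2) (1 / 2)"
  have \<delta>: "\<delta> > 0" "\<delta> \<le> 1 / 2" "2 * \<delta> \<le> \<epsilon>" using assms by (auto simp: \<delta>_def)
  obtain C where C: "C \<ge> 1" "\<And>n. n > 0 \<Longrightarrow> 2 ^ card (prime_factors n) \<le> C * real n powr \<delta>"
    using two_power_omega_le[OF \<delta>(1)] by blast
  have "\<exists>J>0. real J \<le> 2 * C ^ 4 * real Q powr \<epsilon> \<and>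
    (\<forall>q\<in>{1..J}. 2 ^ card (prime_factors (Q * q)) \<le> J)" if Q: "Q > 0" for Q :: nat
  proof -
    \<comment> \<open>The exponent is at most 1/2 so that the factor \<open>q powr \<delta> \<le> sqrt J\<close> can be absorbed in \<open>J\<close>.\<close>
    define Y where "Y = C ^ 2 * real Q powr \<delta>"
    define J where "J = nat \<lceil>Y\<^sup>2\<rceil>"
    have Q1: "real Q powr \<delta> \<ge> 1" using Q \<delta>(1) by (simp add: ge_one_powr_ge_zero)
    have Y: "Y \<ge> 1" unfolding Y_def using C(1) Q1 by (metis mult_ge1_I one_le_power)
    then have Y2: "Y\<^sup>2 \<ge> 1" by simp
    have J: "Y\<^sup>2 \<le> real J" "real J \<le> Y\<^sup>2 + 1" using Y2 by (auto simp: J_def)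
    have "J > 0" using J Y2 by linarith
    moreover have "real J \<le> 2 * C ^ 4 * real Q powr \<epsilon>"
    proof -
      have "real J \<le> 2 * Y\<^sup>2" using J Y2 by linarith
      also have "\<dots> = 2 * C ^ 4 * real Q powr (2 * \<delta>)"
      proof -
        have "(real Q powr \<delta>)\<^sup>2 = real Q powr (2 * \<delta>)"
          by (simp add: power2_eq_square flip: powr_add)
        then show ?thesis by (simp add: Y_def power_mult_distrib)
      qed
      also have "\<dots> \<le> 2 * C ^ 4 * real Q powr \<epsilon>"
        using Q \<delta>(3) C(1) by (intro mult_left_mono powr_mono) auto
      finally show ?thesis .
    qed
    moreover have "2 ^ card (prime_factors (Q * q)) \<le> J" if q: "q \<in> {1..J}" for q
    proof -
      have "real (2 ^ card (prime_factors (Q * q))) \<le> C * real (Q * q) powr \<delta>"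
        using C(2)[of "Q * q"] Q q by simp
      also have "\<dots> = C * real Q powr \<delta> * real q powr \<delta>" by (simp add: powr_mult)
      also have "\<dots> \<le> Y * sqrt (real J)"
      proof (intro mult_mono)
        show "C * real Q powr \<delta> \<le> Y"
          unfolding Y_def using C(1) by (intro mult_right_mono) (auto simp: power2_eq_square)
        have "real q powr \<delta> \<le> real q powr (1 / 2)" using q \<delta>(2) by (intro powr_mono) auto
        also have "\<dots> \<le> sqrt (real J)" using q by (simp add: powr_half_sqrt)
        finally show "real q powr \<delta> \<le> sqrt (real J)" .
      qed (use Y in auto)
      also have "\<dots> \<le> sqrt (real J) * sqrt (real J)"
        using J(1) by (intro mult_right_mono real_le_rsqrt) auto
      finally show ?thesis by simp
    qed
    ultimately show ?thesis by blast
  qed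
  moreover have "2 * C ^ 4 \<ge> 1" using one_le_power[OF C(1), of 4] by linarith
  ultimately show ?thesis by blast
qed

theorem theorem1:
  fixes \<epsilon> :: real
  assumes "\<epsilon> > 0"
  shows "\<exists>C::real. C > 0 \<and> (\<forall>Q::nat. Q \<ge> 1 \<longrightarrow>
    generate SL2Z {\<gamma> \<in> Gamma0 Q. frobenius_norm \<gamma> \<le> C * real Q powr (1 + \<epsilon>)} = Gamma0 Q)"
proof -
  interpret group SL2Z by (rule group_SL2Z)
  \<comment> \<open>The exponent is halved because the threshold \<open>Q * J\<^sup>2\<close>
    contains the square of \<open>J\<close>. The factor 4 in the final constant is the loss in
    passing from the lower left entry to the norm.\<close>
  obtain D where D: "D \<ge> 1" "\<And>Q. Q > 0 \<Longrightarrow> \<exists>J>0. real J \<le> D * real Q powr (\<epsilon> / 2) \<and>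
    (\<forall>q\<in>{1..J}. 2 ^ card (prime_factors (Q * q)) \<le> J)"
    using exists_sieve_bound[of "\<epsilon> / 2"] assms by auto
  have "generate SL2Z {\<gamma> \<in> Gamma0 Q. frobenius_norm \<gamma> \<le> 4 * D\<^sup>2 * real Q powr (1 + \<epsilon>)} = Gamma0 Q"
    if Q: "Q \<ge> 1" for Q
  proof -
    let ?S = "{\<gamma> \<in> Gamma0 Q. frobenius_norm \<gamma> \<le> 4 * D\<^sup>2 * real Q powr (1 + \<epsilon>)}"
    have S: "?S \<subseteq> carrier SL2Z" by (auto simp: Gamma0_def)
    then have H: "subgroup (generate SL2Z ?S) SL2Z" by (rule generate_is_subgroup)
    obtain J where J: "J > 0" "real J \<le> D * real Q powr (\<epsilon> / 2)"
      "\<And>q. q \<in> {1..J} \<Longrightarrow> 2 ^ card (prime_factors (Q * q)) \<le> J"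
      using D(2)[of Q] Q by auto
    have "real (Q * J\<^sup>2) \<le> real Q * (D * real Q powr (\<epsilon> / 2))\<^sup>2"
      using J(2) by (simp add: mult_left_mono power_mono)
    also have "\<dots> = D\<^sup>2 * real Q powr (1 + \<epsilon>)"
      using Q by (simp add: power_mult_distrib powr_power powr_add)
    finally have bound: "real (Q * J\<^sup>2) \<le> D\<^sup>2 * real Q powr (1 + \<epsilon>)" .
    have "Gamma0 Q \<subseteq> generate SL2Z ?S"
    proof (rule Gamma0_subset_if_small_lower_left[OF H _ J(1,3)])
      fix a b c d assume \<gamma>: "mat2 a b c d \<in> Gamma0 Q" and "\<bar>c\<bar> \<le> int (Q * J\<^sup>2)"
      then have "\<bar>real_of_int c\<bar> \<le> real (Q * J\<^sup>2)" by linarith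
      then show "mat2 a b c d \<in> generate SL2Z ?S"
      proof (rule small_lower_left_in_subgroup[OF H _ _ \<gamma>, rotated 2])
        show "1 \<le> real (Q * J\<^sup>2)"
          using Q J(1) by (subst of_nat_1[symmetric], subst of_nat_le_iff) (simp add: Suc_le_eq)
      qed (use bound in \<open>auto intro: generate.incl\<close>)
    qed (use Q in auto)
    moreover have "generate SL2Z ?S \<subseteq> Gamma0 Q"
      by (rule generate_subgroup_incl[OF _ subgroup_Gamma0]) auto
    ultimately show ?thesis by blast
  qed
  moreover have "4 * D\<^sup>2 > 0" using D(1) by simp
  ultimately show ?thesis by blast
qed

end
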